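(* Let $B\ge1$ be an integer, let $\theta$ be an irrational real number with $0\le\theta<1$ whose partial quotients are bounded by $B$, let $\beta$ be a real number with $0\le\beta<1$, and let $N\ge1$ be an integer. Then there exist integers $n,p$ with $0\le n\le N$ and $|p|\le N$ such that $|n\theta-p-\beta|<\frac{f(B)}{2N}$.
   Context: $\theta=[a_0;a_1,a_2,\ldots]$ has partial quotients bounded by $B$ if $|a_i|\le B$ for all $i\ge1$; ${\cal S}_B$ is the set of such irrational $\theta$. For irrational $\theta$ and integer $N\ge1$, sort $0,\{\theta\},\ldots,\{N\theta\},1$ (fractional parts) as $0=s_0<s_1<\cdots<s_{N+1}=1$ and let $H(\theta,N)=\max_{0\le i\le N}(s_{i+1}-s_i)$. Define $f(B)=\sup_{\theta\in{\cal S}_B}\sup_{N\in\mathbb{N}}N\cdot H(\theta,N)$. *)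

theory Defs
  imports Complex_Main
begin

text \<open>Complete quotients and partial quotients of the regular continued fraction
  \<open>[a\<^sub>0; a\<^sub>1, a\<^sub>2, \<dots>]\<close> of a real number. The expansion of an irrational number never terminates,
  so the convention \<open>1 / 0 = 0\<close> plays no role on the sets considered below.\<close>

primrec complete_quotient :: "real \<Rightarrow> nat \<Rightarrow> real" where
  "complete_quotient \<theta> 0 = \<theta>"
| "complete_quotient \<theta> (Suc i) = 1 / frac (complete_quotient \<theta> i)"

definition partial_quotient :: "real \<Rightarrow> nat \<Rightarrow> int" where
  "partial_quotient \<theta> i = \<lfloor>complete_quotient \<theta> i\<rfloor>"

definition pq_bounded_by :: "nat \<Rightarrow> real \<Rightarrow> bool" where
  "pq_bounded_by B \<theta> \<longleftrightarrow> (\<forall>i\<ge>1. \<bar>partial_quotient \<theta> i\<bar> \<le> int B)"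

definition S_set :: "nat \<Rightarrow> real set" where
  "S_set B = {\<theta>. \<theta> \<notin> \<rat> \<and> pq_bounded_by B \<theta>}"

text \<open>For irrational \<open>\<theta>\<close> the points are pairwise distinct, so the list has length \<open>N + 2\<close>.\<close>

definition sorted_points :: "real \<Rightarrow> nat \<Rightarrow> real list" where
  "sorted_points \<theta> N =
     sorted_list_of_set ({0, 1} \<union> (\<lambda>n. frac (real n * \<theta>)) ` {1..N})"

definition max_gap :: "real \<Rightarrow> nat \<Rightarrow> real" where
  "max_gap \<theta> N =
     Max ((\<lambda>i. sorted_points \<theta> N ! Suc i - sorted_points \<theta> N ! i) ` {0..N})"

definition f_sup :: "nat \<Rightarrow> real" where
  "f_sup B = (SUP \<theta>\<in>S_set B. SUP N\<in>{1..}. real N * max_gap \<theta> N)"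

end

theory Submission
  imports Defs
begin

text \<open>The points \<open>(n, n\<theta> - p)\<close> form a lattice of covolume 1, and a gap of length \<open>h\<close> among
  \<open>0, {\<theta>}, \<dots>, {N\<theta>}, 1\<close> is the same as a lattice-free open rectangle of width \<open>N + 2\<close> and
  height \<open>h\<close> whose vertical sides lie over \<open>-1\<close> and \<open>N + 1\<close>. The nearest end point of the gap
  containing \<open>\<beta>\<close> has distance at most half the gap, so everything reduces to the strict inequality
  \<open>N H(\<theta>, N) < f(B)\<close>. Swapping the roles of \<open>n\<close> and \<open>p\<close> identifies the lattices of \<open>\<tau>\<close> and
  \<open>1 / \<tau>\<close> up to scaling and a shear, and carries an empty rectangle of size \<open>L \<times> h\<close> to one of
  size \<open>(\<tau> L - h) \<times> (h / \<tau>)\<close>. Iterating this along the continued fraction of \<open>\<theta>\<close> shows that the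
  areas of empty rectangles are bounded in terms of \<open>B\<close>, so that \<open>f(B)\<close> is a genuine supremum.
  Applying it once in the opposite direction, from \<open>\<theta>\<close> to \<open>1 / (B + \<theta>)\<close>, produces a larger value
  of \<open>N H\<close>, because the loss of area is smaller than the discrepancy between \<open>N h\<close> and
  \<open>(N + 2) h\<close>; so the supremum is not attained.\<close>

section \<open>Lattice-free rectangles and the exchange of coordinates\<close>

definition empty_rect :: "real \<Rightarrow> real \<Rightarrow> real \<Rightarrow> real \<Rightarrow> real \<Rightarrow> bool" where
  "empty_rect \<theta> x L y h \<longleftrightarrow>
     (\<forall>n p :: int. \<not> (x < of_int n \<and> of_int n < x + L \<and>
        y < of_int n * \<theta> - of_int p \<and> of_int n * \<theta> - of_int p < y + h))"

lemma empty_rect_add_int: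
  assumes "empty_rect \<theta> x L y h"
  shows "empty_rect (\<theta> + of_int b) x L y h"
  unfolding empty_rect_def
proof (intro allI)
  fix n p :: int
  have "of_int n * (\<theta> + of_int b) - of_int p = of_int n * \<theta> - of_int (p - n * b)"
    by (simp add: algebra_simps)
  then show "\<not> (x < of_int n \<and> of_int n < x + L \<and> y < of_int n * (\<theta> + of_int b) - of_int p \<and>
      of_int n * (\<theta> + of_int b) - of_int p < y + h)"
    using assms unfolding empty_rect_def by metis
qed

text \<open>A point \<open>(n, p)\<close> in the new rectangle would come from
  \<open>(- p, - n)\<close> in the old one: scaling its height by \<tau> gives
  \<open>v = n - p * \<tau>\<close>, so \<open>- p * \<tau> = v - n\<close>. The new horizontal side
  is chosen so that \<open>v - n\<close> stays between \<open>x * \<tau>\<close> and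
  \<open>(x + L) * \<tau>\<close> for every \<open>v\<close> between \<open>y\<close> and
  \<open>y + h\<close>; this uniformity costs \<open>h\<close> in width. A negative width is
  harmless, as the rectangle then contains nothing.\<close>

lemma empty_rect_inverse:
  assumes "\<tau> > 0" and e: "empty_rect \<tau> x L y h"
  shows "empty_rect (1 / \<tau>) (y + h - (x + L) * \<tau>) (\<tau> * L - h) (y / \<tau>) (h / \<tau>)"
  unfolding empty_rect_def
proof (intro allI notI, elim conjE)
  fix n p :: int
  assume a: "y + h - (x + L) * \<tau> < of_int n"
    "of_int n < y + h - (x + L) * \<tau> + (\<tau> * L - h)"
    "y / \<tau> < of_int n * (1 / \<tau>) - of_int p"
    "of_int n * (1 / \<tau>) - of_int p < y / \<tau> + h / \<tau>"
  have eq: "(of_int n * (1 / \<tau>) - of_int p) * \<tau> = of_int n - of_int p * \<tau>"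
    "(y / \<tau> + h / \<tau>) * \<tau> = y + h"
    using \<open>\<tau> > 0\<close> by (simp_all add: field_simps)
  have v1: "y < of_int n - of_int p * \<tau>" and v2: "of_int n - of_int p * \<tau> < y + h"
    using mult_strict_right_mono[OF a(3) \<open>\<tau> > 0\<close>] mult_strict_right_mono[OF a(4) \<open>\<tau> > 0\<close>] \<open>\<tau> > 0\<close>
    by (simp_all only: eq) simp_all
  have "x * \<tau> < - of_int p * \<tau>" "- of_int p * \<tau> < (x + L) * \<tau>"
    using a(1,2) v1 v2 by (simp_all add: algebra_simps)
  then have "x < of_int (- p)" "of_int (- p) < x + L"
    using \<open>\<tau> > 0\<close> mult_less_cancel_right_pos[OF \<open>\<tau> > 0\<close>] by (metis of_int_minus)+
  moreover have "y < of_int (- p) * \<tau> - of_int (- n)" "of_int (- p) * \<tau> - of_int (- n) < y + h"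
    using v1 v2 by simp_all
  ultimately show False
    using e unfolding empty_rect_def by blast
qed

text \<open>Lattice points over a fixed integer have spacing 1, so an open height above 1 would
  catch one; hence no integer lies in the open horizontal side.\<close>

lemma empty_rect_width_le_1:
  assumes e: "empty_rect \<theta> x L y h" and "h > 1"
  shows "L \<le> 1"
proof (rule ccontr)
  assume "\<not> L \<le> 1"
  define n where "n = \<lfloor>x\<rfloor> + 1"
  define p where "p = \<lceil>of_int n * \<theta> - y\<rceil> - 1"
  have "x < of_int n" "of_int n < x + L"
    using \<open>\<not> L \<le> 1\<close> unfolding n_def by linarith+
  moreover have "y < of_int n * \<theta> - of_int p" "of_int n * \<theta> - of_int p < y + h"
    using \<open>h > 1\<close> unfolding p_def by linarith+
  ultimately show False
    using e unfolding empty_rect_def by blast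
qed

section \<open>Shifting the continued fraction expansion, and the area bound\<close>

lemma complete_quotient_Suc_shift:
  "complete_quotient \<theta> (Suc i) = complete_quotient (1 / frac \<theta>) i"
  by (induction i) auto

lemma complete_quotient_add_int:
  "complete_quotient (\<theta> + of_int b) (Suc i) = complete_quotient \<theta> (Suc i)"
  by (induction i) (auto simp: frac_def)

lemma frac_irrational_pos:
  assumes "\<theta> \<notin> \<rat>"
  shows "0 < frac \<theta>"
  using assms by (meson Ints_subset_Rats frac_gt_0_iff subsetD)

lemma inverse_frac_irrational:
  assumes "(\<theta> :: real) \<notin> \<rat>"
  shows "1 / frac \<theta> \<notin> \<rat>"
proof
  assume "1 / frac \<theta> \<in> \<rat>"
  from Rats_add[OF Rats_divide[OF Rats_1 this] Rats_of_int[of "\<lfloor>\<theta>\<rfloor>"]]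
  have "1 / (1 / frac \<theta>) + of_int \<lfloor>\<theta>\<rfloor> \<in> \<rat>" .
  then show False
    using assms by (simp add: frac_def)
qed

lemma inverse_frac_in_S_set:
  assumes "\<theta> \<in> S_set B"
  shows "1 / frac \<theta> \<in> S_set B"
proof -
  have "\<bar>partial_quotient (1 / frac \<theta>) i\<bar> \<le> int B" for i
    using assms complete_quotient_Suc_shift[of \<theta> i]
    unfolding S_set_def pq_bounded_by_def partial_quotient_def
    by (metis (mono_tags, lifting) le_add1 mem_Collect_eq plus_1_eq_Suc)
  then show ?thesis
    using assms inverse_frac_irrational by (auto simp: S_set_def pq_bounded_by_def)
qed

lemma inverse_frac_less:
  assumes "\<theta> \<in> S_set B"
  shows "1 / frac \<theta> < real B + 1"
proof -
  have "\<bar>partial_quotient \<theta> 1\<bar> \<le> int B"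
    using assms by (auto simp: S_set_def pq_bounded_by_def)
  then have "\<lfloor>1 / frac \<theta>\<rfloor> \<le> int B"
    by (simp add: partial_quotient_def)
  then show ?thesis
    by linarith
qed

text \<open>The integer part is at least 1, and the fractional part is the reciprocal of the next
  complete quotient, which is below \<open>B + 1\<close>. This provides the growth factor of the
  heights.\<close>

lemma inverse_frac_greater:
  assumes "\<theta> \<in> S_set B"
  shows "1 + 1 / (real B + 1) < 1 / frac \<theta>"
proof -
  define t where "t = 1 / frac \<theta>"
  have tS: "t \<in> S_set B"
    unfolding t_def by (rule inverse_frac_in_S_set[OF assms])
  then have "0 < frac t"
    using frac_irrational_pos by (auto simp: S_set_def)
  then have "1 / (real B + 1) < frac t"
    using inverse_frac_less[OF tS] by (simp add: field_simps)
  moreover have "1 < t"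
    using frac_irrational_pos[of \<theta>] frac_lt_1[of \<theta>] assms by (auto simp: t_def S_set_def)
  then have "1 \<le> \<lfloor>t\<rfloor>"
    by simp
  then have "1 + frac t \<le> t"
    unfolding frac_def by linarith
  ultimately show ?thesis
    unfolding t_def by linarith
qed

text \<open>The correction term \<open>- (B + 2) h\<^sup>2\<close> absorbs the loss \<open>h\<^sup>2 / frac \<theta>\<close> of area in each step, the
  heights growing geometrically until they exceed 1.\<close>

lemma empty_rect_area_bound_aux:
  assumes "\<theta> \<in> S_set B" and "0 < h" and "h \<le> real B + 1"
    and "1 < h * (1 + 1 / (real B + 1)) ^ k" and "empty_rect \<theta> x L y h"
  shows "L * h \<le> (real B + 1) + (real B + 2) * (real B + 1)\<^sup>2 - (real B + 2) * h\<^sup>2"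
proof -
  let ?K = "(real B + 1) + (real B + 2) * (real B + 1)\<^sup>2"
  \<comment> \<open>\<open>?K\<close> is chosen so that the right-hand side is at least
    \<open>B + 1\<close> whenever \<open>0 < h \<le> B + 1\<close>.\<close>
  have base: "L * h \<le> ?K - (real B + 2) * h\<^sup>2"
    if "1 < h" "h \<le> real B + 1" "empty_rect \<theta> x L y h" for \<theta> h x L y
  proof -
    have "L * h \<le> real B + 1"
      using mult_right_mono[of L 1 h] empty_rect_width_le_1[OF that(3,1)] that(1,2) by linarith
    moreover have "(real B + 2) * h\<^sup>2 \<le> (real B + 2) * (real B + 1)\<^sup>2"
      using that by (intro mult_left_mono power_mono) auto
    ultimately show ?thesis
      by linarith
  qed
  show ?thesis
    using assms
  \<comment> \<open>\<open>k\<close> counts the exchanges still allowed before the height must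
    exceed 1; each one uses up a factor of the power.\<close>
  proof (induction k arbitrary: \<theta> h x L y)
    case (0 \<theta> h x L y)
    then show ?case
      using base by simp
  next
    case (Suc k \<theta> h x L y)
    show ?case
    proof (cases "h > 1")
      case True
      then show ?thesis
        using base Suc.prems by simp
    next
      case False
      define t where "t = frac \<theta>"
      define r where "r = 1 + 1 / (real B + 1)"
      have t: "0 < t" "1 / t < real B + 1" "r < 1 / t"
        using Suc.prems(1) frac_irrational_pos inverse_frac_less inverse_frac_greater
        by (auto simp: t_def r_def S_set_def)
      have "empty_rect t x L y h"
        using empty_rect_add_int[OF Suc.prems(5), of "- \<lfloor>\<theta>\<rfloor>"] by (simp add: t_def frac_def)
      note e = empty_rect_inverse[OF t(1) this]
      \<comment> \<open>An exchange is made only while \<open>h \<le> 1\<close>, so the new height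
        stays below \<open>B + 1\<close>.\<close>
      have "h / t \<le> 1 / t"
        using False t(1) by (simp add: divide_right_mono)
      then have ht: "h / t \<le> real B + 1"
        using t(2) by linarith
      have "1 < (h * r) * r ^ k"
        using Suc.prems(4) by (simp add: r_def mult_ac)
      also have "\<dots> \<le> (h / t) * r ^ k"
        using t(3) Suc.prems(2) mult_left_mono[of r "1 / t" h]
        by (intro mult_right_mono) (auto simp: r_def)
      finally have growth: "1 < (h / t) * (1 + 1 / (real B + 1)) ^ k"
        by (simp only: r_def)
      have "1 / t \<in> S_set B" "0 < h / t"
        using inverse_frac_in_S_set[OF Suc.prems(1)] Suc.prems(2) t(1) by (simp_all add: t_def)
      note IH = Suc.IH[OF this ht growth e]
      have "L * h = (t * L - h) * (h / t) + h\<^sup>2 / t"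
        using t(1) by (simp add: field_simps power2_eq_square)
      also have "\<dots> \<le> ?K - (real B + 2) * (h / t)\<^sup>2 + h\<^sup>2 / t"
        using IH by simp
      also have "\<dots> \<le> ?K - (real B + 2) * h\<^sup>2"
      proof -
        \<comment> \<open>The loss \<open>h^2 / t\<close> must not exceed the growth
          \<open>(B + 2) * (h^2 / t^2 - h^2)\<close> of the correction, that is,
          \<open>t + (B + 2) * t^2 \<le> B + 2\<close>. This follows from
          \<open>t < 1 / r = (B + 1) / (B + 2)\<close>.\<close>
        have "real B + 2 < (real B + 1) * (1 / t)"
          using t(3) by (simp add: r_def field_simps)
        then have tle: "t * (real B + 2) < real B + 1"
          using t(1) by (simp add: field_simps)
        then have "1 \<le> (real B + 2) * (1 - t)"
          by (simp add: algebra_simps)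
        moreover have "t < 1"
          by (simp add: t_def frac_lt_1)
        ultimately have "t * 1 \<le> (1 + t) * ((real B + 2) * (1 - t))"
          using t(1) by (intro mult_mono) auto
        then have "t + (real B + 2) * t\<^sup>2 \<le> real B + 2"
          by (simp add: algebra_simps power2_eq_square)
        then have "h\<^sup>2 / t\<^sup>2 * (t + (real B + 2) * t\<^sup>2) \<le> h\<^sup>2 / t\<^sup>2 * (real B + 2)"
          by (intro mult_left_mono) auto
        moreover have "h\<^sup>2 / t\<^sup>2 * (t + (real B + 2) * t\<^sup>2) = h\<^sup>2 / t + (real B + 2) * h\<^sup>2"
          using t(1) by (simp add: field_simps power2_eq_square)
        ultimately show ?thesis
          by (simp add: power_divide algebra_simps)
      qed
      finally show ?thesis .
    qed
  qed
qed

lemma empty_rect_area_bound: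
  assumes "\<theta> \<in> S_set B" and "0 < h" and "h \<le> 1" and "empty_rect \<theta> x L y h"
  shows "L * h \<le> (real B + 1) + (real B + 2) * (real B + 1)\<^sup>2"
proof -
  obtain k where "1 / h < (1 + 1 / (real B + 1)) ^ k"
    using real_arch_pow[of "1 + 1 / (real B + 1)" "1 / h"] by auto
  then have "1 < h * (1 + 1 / (real B + 1)) ^ k"
    using assms(2) by (simp add: field_simps)
  then have "L * h \<le> (real B + 1) + (real B + 2) * (real B + 1)\<^sup>2 - (real B + 2) * h\<^sup>2"
    using assms by (intro empty_rect_area_bound_aux) auto
  moreover have "0 \<le> (real B + 2) * h\<^sup>2"
    by simp
  ultimately show ?thesis
    by linarith
qed

section \<open>Gaps between the points on the circle as empty rectangles\<close>

definition circle_points :: "real \<Rightarrow> nat \<Rightarrow> real set" where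
  "circle_points \<theta> N = {0, 1} \<union> (\<lambda>n. frac (real n * \<theta>)) ` {1..N}"

lemma circle_points_iff:
  "s \<in> circle_points \<theta> N \<longleftrightarrow> s = 1 \<or> (\<exists>n\<le>N. s = frac (real n * \<theta>))"
proof
  assume "s = 1 \<or> (\<exists>n\<le>N. s = frac (real n * \<theta>))"
  then consider "s = 1" | n where "n \<le> N" "s = frac (real n * \<theta>)"
    by blast
  then show "s \<in> circle_points \<theta> N"
  proof cases
    case 2
    then show ?thesis
      by (cases "n = 0") (auto simp: circle_points_def)
  qed (simp add: circle_points_def)
qed (force simp: circle_points_def)

lemma card_circle_points:
  assumes "\<theta> \<notin> \<rat>"
  shows "card (circle_points \<theta> N) = N + 2"
proof -
  have inj: "inj (\<lambda>n. frac (real n * \<theta>))"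
  proof (rule injI, rule ccontr)
    fix m n :: nat
    assume eq: "frac (real m * \<theta>) = frac (real n * \<theta>)" and "m \<noteq> n"
    then have "\<theta> = of_int (\<lfloor>real m * \<theta>\<rfloor> - \<lfloor>real n * \<theta>\<rfloor>) / of_int (int m - int n)"
      by (simp add: frac_def field_simps)
    also have "\<dots> \<in> \<rat>"
      by (intro Rats_divide Rats_of_int)
    finally show False
      using assms by simp
  qed
  have "circle_points \<theta> N = insert 1 ((\<lambda>n. frac (real n * \<theta>)) ` {..N})"
    using circle_points_iff by auto
  moreover have "1 \<notin> (\<lambda>n. frac (real n * \<theta>)) ` {..N}"
    using frac_lt_1 less_irrefl by (metis (no_types, lifting) imageE)
  ultimately show ?thesis
    using card_image[OF inj_on_subset[OF inj subset_UNIV], of "{..N}"] by simp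
qed

lemma sorted_points_props:
  assumes "\<theta> \<notin> \<rat>"
  shows "set (sorted_points \<theta> N) = circle_points \<theta> N"
    and "length (sorted_points \<theta> N) = N + 2"
    and "sorted_wrt (<) (sorted_points \<theta> N)"
proof -
  have eq: "sorted_points \<theta> N = sorted_list_of_set (circle_points \<theta> N)"
    by (simp add: sorted_points_def circle_points_def)
  have "finite (circle_points \<theta> N)"
    by (simp add: circle_points_def)
  then show "set (sorted_points \<theta> N) = circle_points \<theta> N"
    and "length (sorted_points \<theta> N) = N + 2"
    and "sorted_wrt (<) (sorted_points \<theta> N)"
    using card_circle_points[OF assms, of N] by (simp_all add: eq)
qed

lemma circle_points_bounds:
  "s \<in> circle_points \<theta> N \<Longrightarrow> 0 \<le> s \<and> s \<le> 1"
  by (auto simp: circle_points_def frac_lt_1 less_imp_le)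

lemma sorted_points_bracket:
  assumes "\<theta> \<notin> \<rat>" and "0 \<le> z" and "z < 1"
  obtains i where "i \<le> N" and "sorted_points \<theta> N ! i \<le> z" and "z < sorted_points \<theta> N ! Suc i"
proof -
  define s where "s = sorted_points \<theta> N"
  note props = sorted_points_props[OF assms(1), of N, folded s_def]
  have "1 \<in> set s" "0 \<in> set s"
    using props(1) by (auto simp: circle_points_def)
  then obtain j k where jk: "j < length s" "s ! j = 1" "k < length s" "s ! k = 0"
    by (meson in_set_conv_nth)
  have s0: "s ! 0 \<le> z"
    using jk props(3) sorted_wrt_nth_less[OF props(3), of 0 k] assms(2) by (cases "k = 0") auto
  define m where "m = (LEAST m. m < length s \<and> z < s ! m)"
  have m: "m < length s \<and> z < s ! m"
    unfolding m_def by (rule LeastI[of _ j]) (use jk assms in auto)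
  with s0 have "m \<noteq> 0"
    by (metis not_less)
  then obtain i where i: "m = Suc i"
    by (cases m) auto
  have "\<not> (i < length s \<and> z < s ! i)"
    using not_less_Least[of i "\<lambda>m. m < length s \<and> z < s ! m"] i by (simp add: m_def)
  then show ?thesis
    using m i props(2) by (intro that[of i]) (auto simp: s_def)
qed

lemma gap_le_max_gap:
  "i \<le> N \<Longrightarrow> sorted_points \<theta> N ! Suc i - sorted_points \<theta> N ! i \<le> max_gap \<theta> N"
  unfolding max_gap_def by (intro Max_ge) auto

text \<open>A lattice point inside would have \<open>0 \<le> n \<le> N\<close> and height in
  \<open>[0, 1)\<close>, so its height would be \<open>frac (n * \<theta>)\<close>, strictly between
  two neighbours.\<close>

lemma max_gap_empty_rect:
  assumes "\<theta> \<notin> \<rat>"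
  obtains y where "empty_rect \<theta> (- 1) (real N + 2) y (max_gap \<theta> N)"
    and "0 < max_gap \<theta> N" and "max_gap \<theta> N \<le> 1"
proof -
  define s where "s = sorted_points \<theta> N"
  note props = sorted_points_props[OF assms, of N, folded s_def]
  have "max_gap \<theta> N \<in> (\<lambda>i. s ! Suc i - s ! i) ` {0..N}"
    unfolding max_gap_def s_def by (intro Max_in) auto
  then obtain i where i: "i \<le> N" "max_gap \<theta> N = s ! Suc i - s ! i"
    by auto
  have lt: "s ! i < s ! Suc i"
    using sorted_wrt_nth_less[OF props(3), of i "Suc i"] i props(2) by simp
  have mem: "s ! i \<in> circle_points \<theta> N" "s ! Suc i \<in> circle_points \<theta> N"
    using props(2) i(1) unfolding props(1)[symmetric] by simp_all
  note bds = circle_points_bounds[OF mem(1)] circle_points_bounds[OF mem(2)]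
  have no_between: "\<not> (s ! i < u \<and> u < s ! Suc i)" if mem_u: "u \<in> circle_points \<theta> N" for u
  proof
    assume u: "s ! i < u \<and> u < s ! Suc i"
    obtain j where j: "j < length s" "u = s ! j"
      using mem_u unfolding props(1)[symmetric] in_set_conv_nth by auto
    note sorted = sorted_nth_mono[OF strict_sorted_imp_sorted[OF props(3)]]
    have "s ! j \<le> s ! i \<or> s ! Suc i \<le> s ! j"
      using sorted[of j i] sorted[of "Suc i" j] j i(1) props(2) by (cases "j \<le> i") auto
    then show False
      using u j by auto
  qed
  have "empty_rect \<theta> (- 1) (real N + 2) (s ! i) (max_gap \<theta> N)"
    unfolding empty_rect_def
  proof (intro allI notI, elim conjE)
    fix n p :: int
    assume a: "- 1 < real_of_int n" "real_of_int n < - 1 + (real N + 2)"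
      "s ! i < of_int n * \<theta> - of_int p" "of_int n * \<theta> - of_int p < s ! i + max_gap \<theta> N"
    define v where "v = of_int n * \<theta> - of_int p"
    have v: "s ! i < v" "v < s ! Suc i"
      using a i by (auto simp: v_def)
    have "0 \<le> v" "v < 1"
      using v bds by linarith+
    then have "v = frac (real (nat n) * \<theta>)"
      using a(1) frac_unique_iff[of "of_int n * \<theta>" v] by (auto simp: v_def)
    moreover have "nat n \<le> N"
      using a(2) by linarith
    ultimately have "v \<in> circle_points \<theta> N"
      using circle_points_iff by blast
    then show False
      using no_between v by blast
  qed
  then show ?thesis
    using that lt bds i by auto
qed

text \<open>The width leaves room for \<open>N + 1\<close> consecutive integers from
  \<open>c\<close> on. Translating column \<open>c\<close> to 0 and the lower side modulo 1 to
  \<open>z\<close>, no point of index at most \<open>N\<close> lies strictly between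
  \<open>z\<close> and \<open>z + h\<close>, so the next circle point above \<open>z\<close> is at
  distance at least \<open>h\<close>.\<close>

lemma empty_rect_imp_max_gap_ge:
  assumes irr: "\<theta> \<notin> \<rat>" and e: "empty_rect \<theta> x L y h" and "h > 0" and "real N + 1 < L"
  shows "h \<le> max_gap \<theta> N"
proof -
  define c where "c = \<lfloor>x\<rfloor> + 1"
  define w where "w = y - of_int c * \<theta>"
  define z where "z = frac w"
  have no_point: "\<not> (z < real n * \<theta> - of_int p \<and> real n * \<theta> - of_int p < z + h)"
    if "n \<le> N" for n and p :: int
  proof -
    have "x < of_int (c + int n)" "of_int (c + int n) < x + L"
      using that assms(4) unfolding c_def by linarith+
    then have "\<not> (y < of_int (c + int n) * \<theta> - of_int (p - \<lfloor>w\<rfloor>) \<and>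
        of_int (c + int n) * \<theta> - of_int (p - \<lfloor>w\<rfloor>) < y + h)"
      using e unfolding empty_rect_def by blast
    moreover have "of_int (c + int n) * \<theta> - of_int (p - \<lfloor>w\<rfloor>) = real n * \<theta> - of_int p + (y - z)"
      unfolding z_def frac_def by (simp add: w_def algebra_simps)
    ultimately show ?thesis
      by auto
  qed
  have z: "0 \<le> z" "z < 1"
    by (simp_all add: z_def frac_lt_1)
  obtain i where i: "i \<le> N" "sorted_points \<theta> N ! i \<le> z" "z < sorted_points \<theta> N ! Suc i"
    using sorted_points_bracket[OF irr z] by blast
  have "sorted_points \<theta> N ! Suc i \<in> circle_points \<theta> N"
    using i(1) sorted_points_props[OF irr, of N]
    by (metis Suc_le_mono add_2_eq_Suc' le_imp_less_Suc nth_mem)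
  then consider "sorted_points \<theta> N ! Suc i = 1"
    | n where "n \<le> N" "sorted_points \<theta> N ! Suc i = frac (real n * \<theta>)"
    using circle_points_iff by blast
  then have "z + h \<le> sorted_points \<theta> N ! Suc i"
  proof cases
    \<comment> \<open>The end point 1 is the lattice height with \<open>n = 0\<close> and
      \<open>p = - 1\<close>.\<close>
    case 1
    then show ?thesis
      using no_point[of 0 "- 1"] i(3) by simp
  next
    case 2
    then show ?thesis
      using no_point[OF 2(1), of "\<lfloor>real n * \<theta>\<rfloor>"] i(3) by (simp add: frac_def)
  qed
  then show ?thesis
    using gap_le_max_gap[OF i(1), of \<theta>] i(2) by linarith
qed

section \<open>Comparison with f(B): boundedness, then strictness\<close>

lemma mult_max_gap_bound:
  assumes "\<theta> \<in> S_set B"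
  shows "real N * max_gap \<theta> N \<le> (real B + 1) + (real B + 2) * (real B + 1)\<^sup>2"
proof -
  have "\<theta> \<notin> \<rat>"
    using assms by (simp add: S_set_def)
  then obtain y where y: "empty_rect \<theta> (- 1) (real N + 2) y (max_gap \<theta> N)"
      "0 < max_gap \<theta> N" "max_gap \<theta> N \<le> 1"
    using max_gap_empty_rect by blast
  have "real N * max_gap \<theta> N \<le> (real N + 2) * max_gap \<theta> N"
    using y by (intro mult_right_mono) auto
  also have "\<dots> \<le> (real B + 1) + (real B + 2) * (real B + 1)\<^sup>2"
    using empty_rect_area_bound[OF assms y(2,3,1)] .
  finally show ?thesis .
qed

text \<open>Both real suprema need bounded families; the bound \<open>?K\<close>, uniform in
  \<theta> and \<open>N\<close>, serves for the inner and the outer one.\<close>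

lemma mult_max_gap_le_f_sup:
  assumes "\<theta> \<in> S_set B" and "N \<ge> 1"
  shows "real N * max_gap \<theta> N \<le> f_sup B"
proof -
  let ?K = "(real B + 1) + (real B + 2) * (real B + 1)\<^sup>2"
  have "real N * max_gap \<theta> N \<le> (SUP N\<in>{1..}. real N * max_gap \<theta> N)"
    using assms mult_max_gap_bound[OF assms(1)] by (intro cSUP_upper bdd_aboveI2[of _ _ ?K]) auto
  also have "\<dots> \<le> f_sup B"
    unfolding f_sup_def
    using assms(1) mult_max_gap_bound
    by (intro cSUP_upper bdd_aboveI2[of _ _ ?K] cSUP_least) auto
  finally show ?thesis .
qed

text \<open>The expansion is \<open>[0; b, a_1, a_2, ...]\<close>, where \<theta> is
  \<open>[0; a_1, a_2, ...]\<close>.\<close>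

lemma inverse_add_in_S_set:
  assumes "\<theta> \<in> S_set B" and "0 < \<theta>" and "\<theta> < 1" and "1 \<le> b" and "b \<le> B"
  shows "1 / (real b + \<theta>) \<in> S_set B"
proof -
  let ?t = "1 / (real b + \<theta>)"
  have irr: "\<theta> \<notin> \<rat>" and bd: "\<And>i. i \<ge> 1 \<Longrightarrow> \<bar>partial_quotient \<theta> i\<bar> \<le> int B"
    using assms(1) by (auto simp: S_set_def pq_bounded_by_def)
  have "?t \<notin> \<rat>"
  proof
    assume "?t \<in> \<rat>"
    from Rats_diff[OF Rats_divide[OF Rats_1 this] Rats_of_nat[of b]]
    have "1 / ?t - real b \<in> \<rat>" .
    then show False
      using irr by simp
  qed
  have "frac ?t = ?t"
    using assms by (simp add: frac_eq)
  then have cq: "complete_quotient ?t (Suc i) = complete_quotient (\<theta> + of_int (int b)) i" for i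
    unfolding complete_quotient_Suc_shift by (simp add: add.commute)
  have "\<bar>partial_quotient ?t (Suc i)\<bar> \<le> int B" for i
  proof (cases i)
    case 0
    have "\<lfloor>\<theta> + of_int (int b)\<rfloor> = int b"
      using assms by (simp add: floor_unique)
    then show ?thesis
      using assms 0 by (simp add: partial_quotient_def cq del: complete_quotient.simps(2) of_int_of_nat_eq)
  next
    case (Suc j)
    have "partial_quotient ?t (Suc i) = partial_quotient \<theta> i"
      unfolding partial_quotient_def cq Suc complete_quotient_add_int ..
    then show ?thesis
      using bd[of i] Suc by simp
  qed
  then have "\<bar>partial_quotient ?t i\<bar> \<le> int B" if "i \<ge> 1" for i
    using that by (cases i) auto
  then show ?thesis
    using \<open>?t \<notin> \<rat>\<close> by (simp add: S_set_def pq_bounded_by_def)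
qed

lemma mult_max_gap_less_f_sup:
  assumes "B \<ge> 1" and S: "\<theta> \<in> S_set B" and "0 < \<theta>" and "\<theta> < 1" and "N \<ge> 1"
  shows "real N * max_gap \<theta> N < f_sup B"
proof -
  define \<tau> h where "\<tau> = real B + \<theta>" and "h = max_gap \<theta> N"
  have irr: "\<theta> \<notin> \<rat>"
    using S by (simp add: S_set_def)
  \<comment> \<open>Since \<open>L - 2 = N * \<tau> + (2 * \<tau> - 2 - h)\<close> and
    \<open>h \<le> 1\<close>, this bound makes the final comparison strict. For \<open>B = 1\<close>
    it comes from \<open>\<theta> > 1 / 2\<close>.\<close>
  have \<tau>: "3 / 2 < \<tau>"
  proof (cases "B = 1")
    case True
    have "1 / \<theta> < 2"
      using inverse_frac_less[OF S] True assms frac_eq[of \<theta>] by simp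
    then show ?thesis
      using True assms by (simp add: \<tau>_def field_simps)
  qed (use assms in \<open>auto simp: \<tau>_def\<close>)
  obtain y where y: "empty_rect \<theta> (- 1) (real N + 2) y h" "0 < h" "h \<le> 1"
    using max_gap_empty_rect[OF irr] h_def by metis
  have "empty_rect \<tau> (- 1) (real N + 2) y h"
    using empty_rect_add_int[OF y(1), of "int B"] by (simp add: \<tau>_def add.commute)
  note e = empty_rect_inverse[OF _ this]
  define L where "L = \<tau> * (real N + 2) - h"
  \<comment> \<open>The largest \<open>M\<close> with \<open>M + 1 < L\<close>, as the passage from
    rectangles back to gaps requires.\<close>
  define M where "M = nat (\<lceil>L\<rceil> - 2)"
  have "3 / 2 * 3 \<le> \<tau> * (real N + 2)"
    using \<tau> assms by (intro mult_mono) auto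
  then have "3 < L"
    using y by (simp add: L_def)
  then have M: "M \<ge> 1" "real M + 1 < L" "L - 2 \<le> real M"
    unfolding M_def by linarith+
  have S': "1 / \<tau> \<in> S_set B"
    unfolding \<tau>_def using assms by (intro inverse_add_in_S_set) auto
  have "h / \<tau> \<le> max_gap (1 / \<tau>) M"
    using S' e \<tau> y M by (intro empty_rect_imp_max_gap_ge[where L = L]) (auto simp: S_set_def L_def)
  then have "real M * (h / \<tau>) \<le> real M * max_gap (1 / \<tau>) M"
    by (intro mult_left_mono) auto
  also have "\<dots> \<le> f_sup B"
    using mult_max_gap_le_f_sup[OF S' M(1)] .
  finally have "real M * (h / \<tau>) \<le> f_sup B" .
  moreover have "(L - 2) * (h / \<tau>) \<le> real M * (h / \<tau>)"
    using M y \<tau> by (intro mult_right_mono) auto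
  moreover have "real N * h < (L - 2) * (h / \<tau>)"
  proof -
    have "real N * \<tau> < L - 2"
      using \<tau> y by (simp add: L_def algebra_simps)
    then have "real N * \<tau> * (h / \<tau>) < (L - 2) * (h / \<tau>)"
      using y \<tau> by (intro mult_strict_right_mono) auto
    then show ?thesis
      using \<tau> by simp
  qed
  ultimately show ?thesis
    by (simp add: h_def)
qed

section \<open>Approximation of \<beta> by an end point of its gap\<close>

lemma circle_point_integer_form:
  assumes "s \<in> circle_points \<theta> N" and "0 \<le> \<theta>" and "\<theta> < 1" and "N \<ge> 1"
  obtains n p :: int where "0 \<le> n" and "n \<le> int N" and "\<bar>p\<bar> \<le> int N" and "s = of_int n * \<theta> - of_int p"
proof -
  from assms(1) consider "s = 1" | n where "n \<le> N" "s = frac (real n * \<theta>)"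
    using circle_points_iff by blast
  then show ?thesis
  proof cases
    case 1
    then show ?thesis
      using that[of 0 "- 1"] assms(4) by simp
  next
    case 2
    have "0 \<le> real n * \<theta>"
      using assms by simp
    moreover have "real n * \<theta> \<le> real N"
      using 2 assms mult_mono[of "real n" "real N" \<theta> 1] by simp
    ultimately have "\<bar>\<lfloor>real n * \<theta>\<rfloor>\<bar> \<le> int N"
      by linarith
    then show ?thesis
      using that[of "int n" "\<lfloor>real n * \<theta>\<rfloor>"] 2 by (simp add: frac_def)
  qed
qed

theorem theorem8:
  fixes B N :: nat and \<theta> \<beta> :: real
  assumes "B \<ge> 1"
    and "\<theta> \<notin> \<rat>" and "0 \<le> \<theta>" and "\<theta> < 1" and "pq_bounded_by B \<theta>"
    and "0 \<le> \<beta>" and "\<beta> < 1"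
    and "N \<ge> 1"
  shows "\<exists>n p :: int. 0 \<le> n \<and> n \<le> int N \<and> \<bar>p\<bar> \<le> int N \<and>
           \<bar>of_int n * \<theta> - of_int p - \<beta>\<bar> < f_sup B / (2 * real N)"
proof -
  have "\<theta> \<noteq> 0"
    using assms(2) by auto
  then have "real N * max_gap \<theta> N < f_sup B"
    using assms by (intro mult_max_gap_less_f_sup) (auto simp: S_set_def)
  \<comment> \<open>All strictness enters here, so \<beta> may be the midpoint of a largest
    gap.\<close>
  then have gap: "max_gap \<theta> N / 2 < f_sup B / (2 * real N)"
    using assms(8) by (simp add: field_simps)
  obtain i where i: "i \<le> N" "sorted_points \<theta> N ! i \<le> \<beta>" "\<beta> < sorted_points \<theta> N ! Suc i"
    using sorted_points_bracket[OF assms(2,6,7)] by blast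
  have mem: "sorted_points \<theta> N ! j \<in> circle_points \<theta> N" if "j \<le> Suc N" for j
    using that sorted_points_props[OF assms(2), of N]
    by (metis add_2_eq_Suc' le_imp_less_Suc nth_mem)
  obtain s where s: "s \<in> circle_points \<theta> N" "\<bar>s - \<beta>\<bar> \<le> max_gap \<theta> N / 2"
  proof (cases "\<beta> - sorted_points \<theta> N ! i \<le> max_gap \<theta> N / 2")
    case True
    then show ?thesis
      using that[OF mem[of i]] i by simp
  next
    case False
    then show ?thesis
      using that[OF mem[of "Suc i"]] i gap_le_max_gap[OF i(1), of \<theta>] by simp
  qed
  obtain n p :: int where np: "0 \<le> n" "n \<le> int N" "\<bar>p\<bar> \<le> int N" "s = of_int n * \<theta> - of_int p"
    using circle_point_integer_form[OF s(1) assms(3,4,8)] .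
  then have "\<bar>of_int n * \<theta> - of_int p - \<beta>\<bar> < f_sup B / (2 * real N)"
    using s(2) gap by simp
  then show ?thesis
    using np by blast
qed

end
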